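(* Let $n \ge 1$ and $\epsilon \in (0,1]$. For $\theta \in \mathbb{R}$ let $P_\theta^n$ be the law of $n$ i.i.d. observations $X_1,\dots,X_n$ from $\mathsf{N}(\theta,1)$, and for a measurable $\widehat\theta : \mathbb{R}^n \to \mathbb{R}$ let $R(\widehat\theta, P_\theta^n) = \mathbb{E}_{P_\theta^n}\left[|\widehat\theta(X_1,\dots,X_n) - \theta|\right]$. Let $\widehat\theta : \mathbb{R}^n \to \mathbb{R}$ be an estimator such that $R(\widehat\theta, P_0^n) \le \frac{\epsilon}{\sqrt n}$. Then for all $\alpha \in [0,1]$ there exists $\theta \in \mathbb{R}$ such that $$R(\widehat\theta, P_\theta^n) \ge \sqrt{\frac{\alpha}{n}}\left[\sqrt[4]{\log\frac1\epsilon} - \sqrt[4]{\frac{\epsilon^{2-2\alpha}}{\alpha}}\right]_+^2 .$$ In particular, if $\epsilon \le 10^{-2}$, then there exists $\theta \in \mathbb{R}$ with $$R(\widehat\theta, P_\theta^n) \ge \frac14\sqrt{\frac{\log\frac1\epsilon}{n}} .$$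
   Context: $[x]_+ = \max\{x,0\}$; $P_0^n$ is $P_\theta^n$ with $\theta=0$. For $\alpha = 0$ the right-hand side of the first bound is interpreted as $0$ (the subtracted term being $+\infty$). *)

theory Defs
  imports "HOL-Probability.Probability"
begin

definition normal_law :: "real \<Rightarrow> real measure" where
  "normal_law \<theta> = density lborel (\<lambda>x. ennreal (normal_density \<theta> 1 x))"

definition normal_sample_law :: "nat \<Rightarrow> real \<Rightarrow> (nat \<Rightarrow> real) measure" where
  "normal_sample_law n \<theta> = (\<Pi>\<^sub>M i\<in>{1..n}. normal_law \<theta>)"

(* The risk is ennreal-valued because an arbitrary measurable estimator may have
   infinite risk at some parameters; the Bochner integral would be 0 there. *)
definition risk :: "nat \<Rightarrow> ((nat \<Rightarrow> real) \<Rightarrow> real) \<Rightarrow> real \<Rightarrow> ennreal" where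
  "risk n est \<theta> = (\<integral>\<^sup>+ x. ennreal \<bar>est x - \<theta>\<bar> \<partial>normal_sample_law n \<theta>)"

definition pos_part :: "real \<Rightarrow> real" where
  "pos_part x = max x 0"

(* At \<alpha> = 0 the second root is 0 (division by 0) rather than infinite, but the
   factor sqrt (\<alpha> / n) makes the value 0, which is the intended convention. *)
definition risk_lower_bound :: "nat \<Rightarrow> real \<Rightarrow> real \<Rightarrow> real" where
  "risk_lower_bound n \<epsilon> \<alpha> =
     sqrt (\<alpha> / real n) *
     (pos_part (root 4 (ln (1 / \<epsilon>)) - root 4 (\<epsilon> powr (2 - 2 * \<alpha>) / \<alpha>)))\<^sup>2"

end

theory Submission
  imports Defs
begin

text \<open>Integrate \<open>sqrt \<bar>b - a\<bar> \<le> sqrt \<bar>T - a\<bar> + sqrt \<bar>T - b\<bar>\<close> under \<open>P\<^sub>b\<close>. The last term is at most the root of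
  the risk at \<open>b\<close>; changing measure to \<open>P\<^sub>a\<close> in the other term and applying the Cauchy--Schwarz
  inequality bounds it by the root of the product of the risk at \<open>a\<close> and the second moment of the
  likelihood ratio. For the normal samples with \<open>a = 0\<close>, \<open>b = \<theta>\<close> this moment is \<open>exp (n \<theta>\<^sup>2)\<close>, and
  \<open>\<theta> = sqrt (\<alpha> ln (1/\<epsilon>) / n)\<close> turns it into \<open>\<epsilon> powr - \<alpha>\<close>. The second bound is the case
  \<open>\<alpha> = 1/2\<close>.\<close>

section \<open>Normal laws, their samples, and product densities\<close>

lemma prob_space_normal_law: "prob_space (normal_law \<theta>)"
  unfolding normal_law_def by (rule prob_space_normal_density) simp

lemma sets_normal_law [measurable_cong]: "sets (normal_law \<theta>) = sets borel"
  by (simp add: normal_law_def)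

lemma product_sigma_finite_normal_law: "product_sigma_finite (\<lambda>i. normal_law (\<theta> i))"
  by (intro product_sigma_finite.intro prob_space_imp_sigma_finite prob_space_normal_law)

lemma prob_space_normal_sample_law: "prob_space (normal_sample_law n \<theta>)"
  unfolding normal_sample_law_def by (intro prob_space_PiM prob_space_normal_law)

lemma sets_normal_sample_law [measurable_cong]:
  "sets (normal_sample_law n \<theta>) = sets (\<Pi>\<^sub>M i\<in>{1..n}. borel)"
  unfolding normal_sample_law_def by (intro sets_PiM_cong) (auto simp: sets_normal_law)

text \<open>A product measure is determined by its values on boxes, and on a box the integral of a
  product of one-coordinate functions factorizes.\<close>

lemma density_PiM_prod:
  assumes "product_sigma_finite M" "product_sigma_finite (\<lambda>i. density (M i) (f i))" "finite I"
    and f: "\<And>i. i \<in> I \<Longrightarrow> f i \<in> borel_measurable (M i)"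
  shows "density (Pi\<^sub>M I M) (\<lambda>x. \<Prod>i\<in>I. f i (x i)) = Pi\<^sub>M I (\<lambda>i. density (M i) (f i))"
proof (rule product_sigma_finite.PiM_eqI[OF assms(2,3)])
  interpret product_sigma_finite M by fact
  show "sets (density (Pi\<^sub>M I M) (\<lambda>x. \<Prod>i\<in>I. f i (x i))) = sets (Pi\<^sub>M I (\<lambda>i. density (M i) (f i)))"
    by (simp, intro sets_PiM_cong) auto
  fix A assume A: "\<And>i. i \<in> I \<Longrightarrow> A i \<in> sets (density (M i) (f i))"
  have meas: "(\<lambda>x. \<Prod>i\<in>I. f i (x i)) \<in> borel_measurable (Pi\<^sub>M I M)"
    using f by (intro borel_measurable_prod_ennreal) (rule measurable_compose[OF measurable_component_singleton])
  \<comment> \<open>Points of the product space are extensional, so a point outside the box fails in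
    some coordinate of \<open>I\<close>, and that factor makes the right-hand product
    vanish.\<close>
  have ind: "(\<Prod>i\<in>I. f i (x i)) * indicator (Pi\<^sub>E I A) x = (\<Prod>i\<in>I. f i (x i) * indicator (A i) (x i))"
    if "x \<in> space (Pi\<^sub>M I M)" for x
  proof (cases "x \<in> Pi\<^sub>E I A")
    case True
    then show ?thesis by (auto intro!: prod.cong simp: PiE_iff)
  next
    case False
    with that obtain i where "i \<in> I" "x i \<notin> A i" by (auto simp: space_PiM PiE_iff)
    with False \<open>finite I\<close> show ?thesis by (auto intro!: prod_zero[symmetric] bexI[of _ i])
  qed
  have "emeasure (density (Pi\<^sub>M I M) (\<lambda>x. \<Prod>i\<in>I. f i (x i))) (Pi\<^sub>E I A)
      = (\<integral>\<^sup>+x. (\<Prod>i\<in>I. f i (x i)) * indicator (Pi\<^sub>E I A) x \<partial>Pi\<^sub>M I M)"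
    using A \<open>finite I\<close> by (intro emeasure_density meas sets_PiM_I_finite) auto
  also have "\<dots> = (\<integral>\<^sup>+x. (\<Prod>i\<in>I. f i (x i) * indicator (A i) (x i)) \<partial>Pi\<^sub>M I M)"
    by (intro nn_integral_cong ind)
  also have "\<dots> = (\<Prod>i\<in>I. \<integral>\<^sup>+x. f i x * indicator (A i) x \<partial>M i)"
    using A f \<open>finite I\<close>
    by (intro product_nn_integral_prod borel_measurable_times_ennreal borel_measurable_indicator) auto
  also have "\<dots> = (\<Prod>i\<in>I. emeasure (density (M i) (f i)) (A i))"
    using A f by (intro prod.cong emeasure_density[symmetric]) auto
  finally show "emeasure (density (Pi\<^sub>M I M) (\<lambda>x. \<Prod>i\<in>I. f i (x i))) (Pi\<^sub>E I A)
      = (\<Prod>i\<in>I. emeasure (density (M i) (f i)) (A i))" .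
qed

section \<open>Likelihood ratio of N(\<theta>,1) against N(0,1) and its second moment\<close>

definition normal_likelihood_ratio :: "real \<Rightarrow> real \<Rightarrow> ennreal" where
  "normal_likelihood_ratio \<theta> x = ennreal (exp (\<theta> * x - \<theta>\<^sup>2 / 2))"

lemma measurable_normal_likelihood_ratio [measurable]:
  "normal_likelihood_ratio \<theta> \<in> borel_measurable borel"
  unfolding normal_likelihood_ratio_def by measurable

lemma normal_density_shift:
  "normal_density 0 1 x * exp (\<theta> * x - \<theta>\<^sup>2 / 2) = normal_density \<theta> 1 x"
proof -
  have "- x\<^sup>2 / 2 + (\<theta> * x - \<theta>\<^sup>2 / 2) = - (x - \<theta>)\<^sup>2 / 2"
    by (simp add: power2_eq_square field_simps)
  then show ?thesis by (simp add: normal_density_def flip: exp_add)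
qed

lemma density_normal_likelihood_ratio:
  "density (normal_law 0) (normal_likelihood_ratio \<theta>) = normal_law \<theta>"
proof -
  have "ennreal (normal_density 0 1 x) * normal_likelihood_ratio \<theta> x = ennreal (normal_density \<theta> 1 x)"
    for x
    by (simp add: normal_likelihood_ratio_def normal_density_shift flip: ennreal_mult)
  then show ?thesis unfolding normal_law_def by (subst density_density_eq) auto
qed

text \<open>The squared ratio at \<theta> is \<open>exp (\<theta>\<^sup>2)\<close> times the ratio
  at 2\<theta>. The latter is the density of the probability law N(2\<theta>,1), so it integrates to
  1 and no Gaussian integral has to be evaluated.\<close>

lemma nn_integral_normal_likelihood_ratio_sq:
  "(\<integral>\<^sup>+x. (normal_likelihood_ratio \<theta> x)\<^sup>2 \<partial>normal_law 0) = ennreal (exp (\<theta>\<^sup>2))"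
proof -
  have "(normal_likelihood_ratio \<theta> x)\<^sup>2 = ennreal (exp (\<theta>\<^sup>2)) * normal_likelihood_ratio (2 * \<theta>) x" for x
  proof -
    have "2 * (\<theta> * x - \<theta>\<^sup>2 / 2) = \<theta>\<^sup>2 + (2 * \<theta> * x - (2 * \<theta>)\<^sup>2 / 2)"
      by (simp add: power2_eq_square field_simps)
    then show ?thesis
      by (simp add: normal_likelihood_ratio_def ennreal_power flip: ennreal_mult exp_add exp_of_nat_mult)
  qed
  then have "(\<integral>\<^sup>+x. (normal_likelihood_ratio \<theta> x)\<^sup>2 \<partial>normal_law 0)
      = ennreal (exp (\<theta>\<^sup>2)) * (\<integral>\<^sup>+x. normal_likelihood_ratio (2 * \<theta>) x \<partial>normal_law 0)"
    by (simp add: nn_integral_cmult)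
  also have "(\<integral>\<^sup>+x. normal_likelihood_ratio (2 * \<theta>) x \<partial>normal_law 0)
      = (\<integral>\<^sup>+x. 1 \<partial>density (normal_law 0) (normal_likelihood_ratio (2 * \<theta>)))"
    by (subst nn_integral_density) auto
  also have "\<dots> = 1"
    unfolding density_normal_likelihood_ratio
    using prob_space.emeasure_space_1[OF prob_space_normal_law] by simp
  finally show ?thesis by simp
qed

lemma measurable_normal_sample_likelihood_ratio:
  "(\<lambda>x. \<Prod>i\<in>{1..n}. normal_likelihood_ratio \<theta> (x i)) \<in> borel_measurable (normal_sample_law n \<theta>')"
  unfolding measurable_cong_sets[OF sets_normal_sample_law refl] by measurable

lemma density_normal_sample_law:
  "density (normal_sample_law n 0) (\<lambda>x. \<Prod>i\<in>{1..n}. normal_likelihood_ratio \<theta> (x i))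
    = normal_sample_law n \<theta>"
  unfolding normal_sample_law_def
  by (subst density_PiM_prod)
     (auto simp: density_normal_likelihood_ratio product_sigma_finite_normal_law)

lemma nn_integral_normal_sample_likelihood_ratio_sq:
  "(\<integral>\<^sup>+x. (\<Prod>i\<in>{1..n}. normal_likelihood_ratio \<theta> (x i))\<^sup>2 \<partial>normal_sample_law n 0)
    = ennreal (exp (real n * \<theta>\<^sup>2))"
proof -
  interpret product_sigma_finite "\<lambda>_::nat. normal_law 0"
    by (rule product_sigma_finite_normal_law)
  have "(\<integral>\<^sup>+x. (\<Prod>i\<in>{1..n}. normal_likelihood_ratio \<theta> (x i))\<^sup>2 \<partial>normal_sample_law n 0)
      = (\<integral>\<^sup>+x. (\<Prod>i\<in>{1..n}. (normal_likelihood_ratio \<theta> (x i))\<^sup>2) \<partial>normal_sample_law n 0)"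
    by (simp add: prod_power_distrib)
  also have "\<dots> = (\<Prod>i\<in>{1..n}. ennreal (exp (\<theta>\<^sup>2)))"
    unfolding normal_sample_law_def
    by (subst product_nn_integral_prod) (auto simp: nn_integral_normal_likelihood_ratio_sq)
  also have "\<dots> = ennreal (exp (real n * \<theta>\<^sup>2))"
    by (simp add: ennreal_power exp_of_nat_mult)
  finally show ?thesis .
qed

section \<open>The two-point constrained risk inequality\<close>

lemma pos_part_mult: "0 \<le> c \<Longrightarrow> pos_part (c * x) = c * pos_part x"
  using mult_right_mono[of x 0 c] by (auto simp: pos_part_def max_def mult_le_0_iff zero_le_mult_iff)

lemma ennreal_le_of_sq_le:
  assumes "(x::ennreal)\<^sup>2 \<le> ennreal (r\<^sup>2)" "0 \<le> r"
  shows "x \<le> ennreal r"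
proof (cases x)
  case (real s)
  with assms have "s\<^sup>2 \<le> r\<^sup>2" by (simp add: ennreal_power)
  then have "s \<le> r" using assms(2) by (rule power2_le_imp_le)
  then show ?thesis using real by (simp add: ennreal_leI)
qed (use assms in \<open>simp add: top_power_ennreal top_unique\<close>)

lemma constrained_risk_inequality:
  fixes T :: "'a \<Rightarrow> real"
  assumes [measurable]: "T \<in> borel_measurable P" "L \<in> borel_measurable P"
    and prob: "prob_space (density P L)"
    and risk_a: "(\<integral>\<^sup>+x. ennreal \<bar>T x - a\<bar> \<partial>P) \<le> ennreal \<delta>"
    and moment: "(\<integral>\<^sup>+x. (L x)\<^sup>2 \<partial>P) \<le> ennreal \<rho>"
    and nonneg: "0 \<le> \<delta>" "0 \<le> \<rho>"
  shows "ennreal ((pos_part (sqrt \<bar>b - a\<bar> - sqrt (\<rho> * \<delta>)))\<^sup>2)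
    \<le> (\<integral>\<^sup>+x. ennreal \<bar>T x - b\<bar> \<partial>density P L)"
proof -
  define A where "A = (\<integral>\<^sup>+x. ennreal (sqrt \<bar>T x - a\<bar>) \<partial>density P L)"
  define B where "B = (\<integral>\<^sup>+x. ennreal (sqrt \<bar>T x - b\<bar>) \<partial>density P L)"
  have one: "(\<integral>\<^sup>+x. 1 \<partial>density P L) = 1"
    using prob_space.emeasure_space_1[OF prob] by simp
  have "A = (\<integral>\<^sup>+x. L x * ennreal (sqrt \<bar>T x - a\<bar>) \<partial>P)"
    unfolding A_def by (rule nn_integral_density) measurable
  \<comment> \<open>This is why the root of the loss is integrated: its square is the loss itself,
    so the second factor is exactly the risk at \<open>a\<close>.\<close>
  then have "A\<^sup>2 \<le> (\<integral>\<^sup>+x. (L x)\<^sup>2 \<partial>P) * (\<integral>\<^sup>+x. (ennreal (sqrt \<bar>T x - a\<bar>))\<^sup>2 \<partial>P)"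
    by (simp add: Cauchy_Schwarz_nn_integral)
  also have "\<dots> \<le> ennreal \<rho> * ennreal \<delta>"
    using moment risk_a by (intro mult_mono) (auto simp: ennreal_power)
  also have "\<dots> = ennreal ((sqrt (\<rho> * \<delta>))\<^sup>2)"
    using nonneg by (simp flip: ennreal_mult)
  finally have A: "A \<le> ennreal (sqrt (\<rho> * \<delta>))"
    by (rule ennreal_le_of_sq_le) (simp add: nonneg)
  \<comment> \<open>Cauchy--Schwarz against the constant 1, whose integral is 1 under a probability
    measure.\<close>
  have B: "B\<^sup>2 \<le> (\<integral>\<^sup>+x. ennreal \<bar>T x - b\<bar> \<partial>density P L)"
    using Cauchy_Schwarz_nn_integral[of "\<lambda>x. ennreal (sqrt \<bar>T x - b\<bar>)" "density P L" "\<lambda>_. 1"] one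
    by (simp add: B_def ennreal_power)
  have sqrt_triangle: "sqrt \<bar>b - a\<bar> \<le> sqrt \<bar>t - a\<bar> + sqrt \<bar>t - b\<bar>" for t
  proof -
    have "sqrt \<bar>b - a\<bar> \<le> sqrt (\<bar>t - a\<bar> + \<bar>t - b\<bar>)" by simp
    also have "\<dots> \<le> sqrt \<bar>t - a\<bar> + sqrt \<bar>t - b\<bar>" by (rule sqrt_add_le_add_sqrt) auto
    finally show ?thesis .
  qed
  have "ennreal (sqrt \<bar>b - a\<bar>) = (\<integral>\<^sup>+x. ennreal (sqrt \<bar>b - a\<bar>) \<partial>density P L)"
    using prob_space.emeasure_space_1[OF prob] by simp
  also have "\<dots> \<le> (\<integral>\<^sup>+x. ennreal (sqrt \<bar>T x - a\<bar>) + ennreal (sqrt \<bar>T x - b\<bar>) \<partial>density P L)"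
    by (intro nn_integral_mono) (simp add: sqrt_triangle flip: ennreal_plus)
  also have "\<dots> = A + B"
    unfolding A_def B_def by (rule nn_integral_add) measurable
  also have "\<dots> \<le> ennreal (sqrt (\<rho> * \<delta>)) + B"
    using A by (rule add_right_mono)
  \<comment> \<open>Subtraction in \<open>ennreal\<close> is truncated at 0, which is the source of
    the positive part.\<close>
  finally have "ennreal (sqrt \<bar>b - a\<bar>) - ennreal (sqrt (\<rho> * \<delta>)) \<le> B"
    by (simp add: ennreal_minus_le_iff)
  then have "ennreal (pos_part (sqrt \<bar>b - a\<bar> - sqrt (\<rho> * \<delta>))) \<le> B"
    using nonneg by (simp add: pos_part_def ennreal_minus max_def ennreal_neg split: if_splits)
  then have "(ennreal (pos_part (sqrt \<bar>b - a\<bar> - sqrt (\<rho> * \<delta>))))\<^sup>2 \<le> B\<^sup>2"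
    by (rule power_mono_ennreal)
  also note B
  finally show ?thesis by (subst (asm) ennreal_power) (simp_all add: pos_part_def)
qed

section \<open>Lower bounds for the normal location model\<close>

lemma risk_ge:
  assumes est: "est \<in> borel_measurable (\<Pi>\<^sub>M i\<in>{1..n}. borel)"
    and "risk n est 0 \<le> ennreal \<delta>" "0 \<le> \<delta>"
  shows "ennreal ((pos_part (sqrt \<bar>\<theta>\<bar> - sqrt (exp (real n * \<theta>\<^sup>2) * \<delta>)))\<^sup>2) \<le> risk n est \<theta>"
proof -
  have "est \<in> borel_measurable (normal_sample_law n 0)"
    using est unfolding measurable_cong_sets[OF sets_normal_sample_law refl] .
  \<comment> \<open>The first \<theta> is the parameter of the likelihood ratio, the second is the
    point \<open>b\<close>; the two coincide here.\<close>
  from constrained_risk_inequality[OF this measurable_normal_sample_likelihood_ratio,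
      unfolded density_normal_sample_law, OF prob_space_normal_sample_law, of 0 \<delta> \<theta> "exp (real n * \<theta>\<^sup>2)" \<theta>]
  show ?thesis
    using assms(2,3) unfolding nn_integral_normal_sample_likelihood_ratio_sq by (simp add: risk_def)
qed

text \<open>At the chosen \<theta> both square roots in \<open>risk_ge\<close> contain the factor
  \<open>c\<close>. Taking it out of the positive part and squaring gives the prefactor
  \<open>sqrt (\<alpha> / real n)\<close>.\<close>

lemma risk_ge_risk_lower_bound:
  assumes n: "n \<ge> 1" and \<epsilon>: "0 < \<epsilon>" "\<epsilon> \<le> 1"
    and est: "est \<in> borel_measurable (\<Pi>\<^sub>M i\<in>{1..n}. borel)"
    and risk_0: "risk n est 0 \<le> ennreal (\<epsilon> / sqrt (real n))"
    and \<alpha>: "0 \<le> \<alpha>"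
  shows "\<exists>\<theta>. ennreal (risk_lower_bound n \<epsilon> \<alpha>) \<le> risk n est \<theta>"
proof (cases "\<alpha> = 0")
  \<comment> \<open>The prefactor vanishes, so every \<theta> is a witness.\<close>
  case True
  then show ?thesis by (simp add: risk_lower_bound_def)
next
  case False
  with \<alpha> have "\<alpha> > 0" by simp
  define l where "l = ln (1 / \<epsilon>)"
  define c where "c = root 4 (\<alpha> / real n)"
  define \<theta> where "\<theta> = sqrt (\<alpha> * l / real n)"
  have l: "0 \<le> l" using \<epsilon> by (simp add: l_def)
  have c: "0 \<le> c" using \<alpha> by (simp add: c_def)
  have "0 \<le> \<theta>" using \<alpha> l by (simp add: \<theta>_def)
  have root4: "root 4 x = sqrt (sqrt x)" for x
    using real_root_mult_exp[of 2 2 x] by (simp add: sqrt_def)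
  have c2: "c\<^sup>2 = sqrt (\<alpha> / real n)"
    using \<alpha> by (simp add: c_def root4)
  have "sqrt \<bar>\<theta>\<bar> = c * root 4 l"
    using \<open>0 \<le> \<theta>\<close> \<alpha> l by (simp add: \<theta>_def c_def root4 real_sqrt_mult real_sqrt_divide)
  \<comment> \<open>The left side is the root of
    \<open>\<epsilon> powr (1 - \<alpha>) / sqrt n\<close>. The \<alpha> in \<open>c\<close> cancels
    the one dividing inside the fourth root, which uses \<alpha> > 0.\<close>
  moreover have "sqrt (exp (real n * \<theta>\<^sup>2) * (\<epsilon> / sqrt (real n))) = c * root 4 (\<epsilon> powr (2 - 2 * \<alpha>) / \<alpha>)"
  proof -
    have "real n * \<theta>\<^sup>2 = - \<alpha> * ln \<epsilon>"
    proof -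
      have "\<theta>\<^sup>2 = \<alpha> * l / real n" using \<alpha> l by (simp add: \<theta>_def)
      then show ?thesis using n \<epsilon> by (simp add: l_def ln_div)
    qed
    then have "exp (real n * \<theta>\<^sup>2) * \<epsilon> = \<epsilon> powr (- \<alpha>) * \<epsilon> powr 1"
      using \<epsilon> by (simp add: powr_def)
    also have "\<dots> = \<epsilon> powr (1 - \<alpha>)"
      by (subst powr_add[symmetric]) simp
    finally have eq: "exp (real n * \<theta>\<^sup>2) * \<epsilon> = \<epsilon> powr (1 - \<alpha>)" .
    have "\<epsilon> powr (2 - 2 * \<alpha>) = (\<epsilon> powr (1 - \<alpha>))\<^sup>2"
      using \<epsilon> by (simp add: power2_eq_square flip: powr_add)
    then have "sqrt (\<epsilon> powr (2 - 2 * \<alpha>)) = \<epsilon> powr (1 - \<alpha>)" by simp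
    then show ?thesis
      using eq \<open>\<alpha> > 0\<close> by (simp add: c_def root4 real_sqrt_mult real_sqrt_divide)
  qed
  ultimately have "sqrt \<bar>\<theta>\<bar> - sqrt (exp (real n * \<theta>\<^sup>2) * (\<epsilon> / sqrt (real n)))
      = c * (root 4 l - root 4 (\<epsilon> powr (2 - 2 * \<alpha>) / \<alpha>))"
    by (simp add: right_diff_distrib)
  then have "(pos_part (sqrt \<bar>\<theta>\<bar> - sqrt (exp (real n * \<theta>\<^sup>2) * (\<epsilon> / sqrt (real n)))))\<^sup>2
      = risk_lower_bound n \<epsilon> \<alpha>"
    using c by (simp add: risk_lower_bound_def pos_part_mult power_mult_distrib c2 flip: l_def)
  with risk_ge[OF est risk_0, of \<theta>] \<epsilon> show ?thesis by auto
qed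

text \<open>At \<alpha> = 1/2 the subtracted term is the fourth root of 2\<epsilon>, at most 2/5 of
  the leading root. The square of the remaining 3/5, times \<open>sqrt (1/2)\<close>, still exceeds
  1/4.\<close>

lemma risk_lower_bound_half:
  assumes \<epsilon>: "0 < \<epsilon>" "\<epsilon> \<le> 1 / 100"
  shows "1 / 4 * sqrt (ln (1 / \<epsilon>) / real n) \<le> risk_lower_bound n \<epsilon> (1 / 2)"
proof -
  define l where "l = ln (1 / \<epsilon>)"
  have "exp 1 \<le> 1 / \<epsilon>"
    by (rule order_trans[OF exp_le]) (use \<epsilon> in \<open>simp add: field_simps\<close>)
  then have "ln (exp 1) \<le> l"
    using \<epsilon> unfolding l_def by (subst ln_le_cancel_iff) auto
  then have l: "1 \<le> l" by simp
  define q where "q = root 4 l"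
  have q: "0 \<le> q" using l by (simp add: q_def)
  have q2: "q\<^sup>2 = sqrt l"
    using real_root_mult_exp[of 2 2 l] l by (simp add: q_def sqrt_def)
  \<comment> \<open>The left side is 2\<epsilon> \<le> 1/50, below 16/625 = 0.0256; then
    \<open>1 \<le> l\<close> applies.\<close>
  have "\<epsilon> powr (2 - 2 * (1 / 2)) / (1 / 2) \<le> (2 / 5) ^ 4 * l"
    using \<epsilon> l by (simp add: power4_eq_xxxx)
  then have "root 4 (\<epsilon> powr (2 - 2 * (1 / 2)) / (1 / 2)) \<le> root 4 ((2 / 5) ^ 4 * l)"
    by simp
  also have "\<dots> = 2 / 5 * q"
    by (simp add: real_root_mult real_root_power_cancel q_def)
  finally have "3 / 5 * q \<le> pos_part (q - root 4 (\<epsilon> powr (2 - 2 * (1 / 2)) / (1 / 2)))"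
    unfolding pos_part_def by linarith
  then have "(3 / 5 * q)\<^sup>2 \<le> (pos_part (q - root 4 (\<epsilon> powr (2 - 2 * (1 / 2)) / (1 / 2))))\<^sup>2"
    using q by (intro power_mono) auto
  then have sq: "9 / 25 * sqrt l \<le> (pos_part (q - root 4 (\<epsilon> powr (2 - 2 * (1 / 2)) / (1 / 2))))\<^sup>2"
    by (simp add: power_mult_distrib q2 power_divide)
  have half: "7 / 10 \<le> sqrt (1 / 2)"
    by (rule real_le_rsqrt) (simp add: power2_eq_square)
  \<comment> \<open>The product of the constants is 63/250 = 0.252.\<close>
  have "1 / 4 * sqrt (l / real n) \<le> (7 / 10) * (9 / 25) * sqrt (l / real n)"
    using l by (intro mult_right_mono) auto
  also have "\<dots> = (7 / 10 * sqrt (1 / real n)) * (9 / 25 * sqrt l)"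
    by (simp add: real_sqrt_divide)
  also have "\<dots> \<le> (sqrt (1 / 2) * sqrt (1 / real n)) *
      (pos_part (q - root 4 (\<epsilon> powr (2 - 2 * (1 / 2)) / (1 / 2))))\<^sup>2"
    using half sq l by (intro mult_mono) auto
  also have "\<dots> = risk_lower_bound n \<epsilon> (1 / 2)"
    by (simp add: risk_lower_bound_def q_def l_def flip: real_sqrt_mult)
  finally show ?thesis by (simp add: l_def)
qed

theorem proposition2:
  fixes n :: nat and \<epsilon> :: real and est :: "(nat \<Rightarrow> real) \<Rightarrow> real"
  assumes "n \<ge> 1"
    and "0 < \<epsilon>" and "\<epsilon> \<le> 1"
    and "est \<in> borel_measurable (\<Pi>\<^sub>M i\<in>{1..n}. borel)"
    and "risk n est 0 \<le> ennreal (\<epsilon> / sqrt (real n))"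
  shows "(\<forall>\<alpha>\<in>{0..1}. \<exists>\<theta>. risk n est \<theta> \<ge> ennreal (risk_lower_bound n \<epsilon> \<alpha>)) \<and>
         (\<epsilon> \<le> 1 / 100 \<longrightarrow>
            (\<exists>\<theta>. risk n est \<theta> \<ge> ennreal (1 / 4 * sqrt (ln (1 / \<epsilon>) / real n))))"
proof (intro conjI ballI impI)
  fix \<alpha> :: real assume "\<alpha> \<in> {0..1}"
  then show "\<exists>\<theta>. risk n est \<theta> \<ge> ennreal (risk_lower_bound n \<epsilon> \<alpha>)"
    using risk_ge_risk_lower_bound[OF assms] by simp
next
  assume "\<epsilon> \<le> 1 / 100"
  then show "\<exists>\<theta>. risk n est \<theta> \<ge> ennreal (1 / 4 * sqrt (ln (1 / \<epsilon>) / real n))"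
    using risk_ge_risk_lower_bound[OF assms, of "1 / 2"]
      risk_lower_bound_half[OF \<open>0 < \<epsilon>\<close>, of n]
    by (meson ennreal_leI order_trans zero_le_divide_1_iff zero_le_numeral)
qed

end
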